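(* If $G$ and $H$ are finite connected graphs, then $\sigma(G \,\Box\, H) \leq \sigma(G) + \sigma(H)$, where $G \,\Box\, H$ is the Cartesian product.
   Context: Surrounding Cops and Robbers on a finite simple graph $G$ with $k \geq 1$ cops and one robber: the cops first choose starting vertices (several cops may share a vertex), then the robber chooses a starting vertex not occupied by a cop, and thereafter the cops and the robber alternate moves, the cops moving first. In a move, each player may move to an adjacent vertex or stay put; the robber may never move to, or remain on, a vertex occupied by a cop, so if a cop moves onto the robber's vertex the robber is compelled to move to a neighbouring vertex not occupied by a cop. The cops win if at any time every neighbour of the robber's vertex is occupied by a cop; the robber wins if he avoids this forever. Play is with perfect information. The surrounding cop number $\sigma(G)$ is the least number of cops for which the cops have a winning strategy. The Cartesian product $G \,\Box\, H$ has vertex set $V(G)\times V(H)$, with $(g,h)$ adjacent to $(g',h')$ iff either $g=g'$ and $hh' \in E(H)$, or $h=h'$ and $gg'\in E(G)$. *)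

theory Defs
  imports "Graph_Theory.Graph_Theory"
begin

text \<open>
  A finite simple graph is a \<^locale>\<open>pair_graph\<close>: a finite, symmetric, loop-free digraph
  without parallel arcs, where an undirected edge \<open>uv\<close> is the pair of arcs \<open>(u, v)\<close>, \<open>(v, u)\<close>.
\<close>

definition nbrs :: "'a pair_pre_digraph \<Rightarrow> 'a \<Rightarrow> 'a set" where
  "nbrs G v = {w. (v, w) \<in> parcs G}"

definition cartesian_product ::
    "'a pair_pre_digraph \<Rightarrow> 'b pair_pre_digraph \<Rightarrow> ('a \<times> 'b) pair_pre_digraph"
    (infixr \<open>\<box>\<close> 70) where
  "G \<box> H = \<lparr> pverts = pverts G \<times> pverts H,
     parcs = {((g, h), (g', h')) | g h g' h'.
       g \<in> pverts G \<and> g = g' \<and> (h, h') \<in> parcs H \<or>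
       h \<in> pverts H \<and> h = h' \<and> (g, g') \<in> parcs G} \<rparr>"

definition legal_step :: "'a pair_pre_digraph \<Rightarrow> 'a \<Rightarrow> 'a \<Rightarrow> bool" where
  "legal_step G u v \<longleftrightarrow> v = u \<or> v \<in> nbrs G u"

text \<open>
  A position of \<open>k\<close> cops is a list of \<open>k\<close> vertices. A strategy \<open>S\<close> maps the list of all robber
  positions seen so far to the position the cops take next: \<open>S []\<close> is their initial placement, and
  \<open>S [r\<^sub>0, \<dots>, r\<^sub>t]\<close> is their position after the move answering \<open>r\<^sub>t\<close>. The cops' own earlier
  positions are determined by \<open>S\<close> and the robber's history, so this is play with perfect
  information. Legality is also demanded after histories that cannot arise in play, which is
  harmless because the cops may always stay put.
\<close>

definition cop_strategy :: "'a pair_pre_digraph \<Rightarrow> nat \<Rightarrow> ('a list \<Rightarrow> 'a list) \<Rightarrow> bool" where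
  "cop_strategy G k S \<longleftrightarrow>
     length (S []) = k \<and> set (S []) \<subseteq> pverts G \<and>
     (\<forall>hist v. list_all2 (legal_step G) (S hist) (S (hist @ [v])))"

definition cops_at :: "('a list \<Rightarrow> 'a list) \<Rightarrow> (nat \<Rightarrow> 'a) \<Rightarrow> nat \<Rightarrow> 'a list" where
  "cops_at S r t = S (map r [0..<t])"

text \<open>
  The order of play is \<open>cops_at S r 0\<close>, \<open>r 0\<close>, \<open>cops_at S r 1\<close>, \<open>r 1\<close>, and so on. The condition
  \<open>r t \<notin> set (cops_at S r t)\<close> covers the initial choice of the robber as well as the rule that he
  may neither move to nor remain on a vertex occupied by a cop.
\<close>

definition robber_play ::
    "'a pair_pre_digraph \<Rightarrow> ('a list \<Rightarrow> 'a list) \<Rightarrow> (nat \<Rightarrow> 'a) \<Rightarrow> bool" where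
  "robber_play G S r \<longleftrightarrow>
     r 0 \<in> pverts G \<and>
     (\<forall>t. r t \<notin> set (cops_at S r t)) \<and>
     (\<forall>t. legal_step G (r t) (r (Suc t)))"

definition surrounded :: "'a pair_pre_digraph \<Rightarrow> 'a list \<Rightarrow> 'a \<Rightarrow> bool" where
  "surrounded G C v \<longleftrightarrow> nbrs G v \<subseteq> set C"

text \<open>
  The robber may become surrounded by his own move or placement (first disjunct) or by a move of
  the cops (second disjunct). It suffices to quantify over infinite plays: a robber without a legal
  move has all his neighbours occupied and so has already lost, and a robber without a legal
  starting vertex (the cops occupy the whole graph) loses as well; the latter is how one cop wins
  on a single vertex.
\<close>

definition winning_cop_strategy ::
    "'a pair_pre_digraph \<Rightarrow> nat \<Rightarrow> ('a list \<Rightarrow> 'a list) \<Rightarrow> bool" where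
  "winning_cop_strategy G k S \<longleftrightarrow>
     cop_strategy G k S \<and>
     (\<forall>r. robber_play G S r \<longrightarrow>
       (\<exists>t. surrounded G (cops_at S r t) (r t) \<or> surrounded G (cops_at S r (Suc t)) (r t)))"

definition cops_win :: "'a pair_pre_digraph \<Rightarrow> nat \<Rightarrow> bool" where
  "cops_win G k \<longleftrightarrow> (\<exists>S. winning_cop_strategy G k S)"

definition surrounding_cop_number :: "'a pair_pre_digraph \<Rightarrow> nat" (\<open>\<sigma>\<close>) where
  "\<sigma> G = (LEAST k. k \<ge> 1 \<and> cops_win G k)"

text \<open>The minimum exists for every nonempty finite graph, since a cop on every vertex wins.\<close>

lemma cops_win_card_verts:
  assumes "finite (pverts G)"
  shows "cops_win G (card (pverts G))"
proof -
  obtain xs where xs: "set xs = pverts G" "distinct xs"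
    using finite_distinct_list[OF assms] by blast
  have "winning_cop_strategy G (card (pverts G)) (\<lambda>_. xs)"
    unfolding winning_cop_strategy_def cop_strategy_def robber_play_def cops_at_def legal_step_def
    using xs by (auto simp: distinct_card[symmetric] intro: list.rel_refl)
  then show ?thesis unfolding cops_win_def by blast
qed

lemma surrounding_cop_number_wellposed:
  assumes "finite (pverts G)" "pverts G \<noteq> {}"
  shows "\<sigma> G \<ge> 1 \<and> cops_win G (\<sigma> G)"
  unfolding surrounding_cop_number_def
  by (rule LeastI[of _ "card (pverts G)"])
     (use assms cops_win_card_verts in \<open>simp add: Suc_le_eq card_gt_0_iff\<close>)

lemma pair_graph_cartesian_product:
  assumes "pair_graph G" "pair_graph H"
  shows "pair_graph (G \<box> H)"
proof -
  interpret G: pair_graph G by fact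
  interpret H: pair_graph H by fact
  have sub: "parcs (G \<box> H) \<subseteq> pverts (G \<box> H) \<times> pverts (G \<box> H)"
    by (auto simp: cartesian_product_def dest: G.in_arcsD1 G.in_arcsD2 H.in_arcsD1 H.in_arcsD2)
  have fin: "finite (pverts (G \<box> H))"
    by (simp add: cartesian_product_def)
  have "sym (parcs G)" "sym (parcs H)"
    using G.pair_sym_arcs H.pair_sym_arcs by (simp_all add: symmetric_def)
  then have sym: "sym (parcs (G \<box> H))"
    by (fastforce simp: cartesian_product_def sym_def)
  show ?thesis
  proof unfold_locales
    show "finite (parcs (G \<box> H))"
      by (rule finite_subset[OF sub]) (simp add: fin)
    show "symmetric (with_proj (G \<box> H))"
      using sym by (simp add: symmetric_def)
    fix e assume "e \<in> parcs (G \<box> H)"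
    then show "fst e \<noteq> snd e"
      by (auto simp: cartesian_product_def dest: G.no_loops' H.no_loops')
  qed (use sub fin in auto)
qed

end

theory Submission
  imports Defs
begin

text \<open>
  With \<open>m = \<sigma> G\<close> and \<open>n = \<sigma> H\<close>, the cops on \<open>G \<box> H\<close> first bring \<open>m\<close> of their number onto the
  robber's \<open>H\<close>-coordinate, one at a time: while fewer than \<open>m\<close> are there, at least \<open>n\<close> others remain,
  and their \<open>H\<close>-coordinates play the winning strategy on \<open>H\<close> until one of them meets the robber's
  \<open>H\<close>-coordinate. These \<open>m\<close> cops then copy every \<open>H\<close>-move of the robber and answer his \<open>G\<close>-moves by
  the winning strategy on \<open>G\<close>, so he can make only finitely many \<open>G\<close>-moves. While he makes none,
  the other \<open>n\<close> cops walk to his \<open>G\<close>-coordinate and play the winning strategy on \<open>H\<close>. Once they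
  surround him in the \<open>H\<close>-direction he must either advance the game on \<open>G\<close> or be surrounded.
\<close>

section \<open>Winning positions of the cops as an inductive predicate\<close>

inductive cops_force :: "'a pair_pre_digraph \<Rightarrow> 'i set \<Rightarrow> ('i \<Rightarrow> 'a) \<Rightarrow> 'a \<Rightarrow> bool"
  for G :: "'a pair_pre_digraph" and J :: "'i set" where
  \<comment> \<open>Cops indexed by \<open>J\<close> stand at \<open>c\<close>, the robber at \<open>v\<close>, and the cops are to move.\<close>
  surrounded: "nbrs G v \<subseteq> c ` J \<Longrightarrow> cops_force G J c v"
| move: "(\<And>i. i \<in> J \<Longrightarrow> legal_step G (c i) (c' i)) \<Longrightarrow>
    (\<And>v'. legal_step G v v' \<Longrightarrow> v' \<notin> c' ` J \<Longrightarrow> cops_force G J c' v') \<Longrightarrow>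
    cops_force G J c v"

text \<open>After such a move every neighbour of the robber is occupied, so his only legal reply is
  to stay, and there he is surrounded.\<close>

lemma cops_force_move_surrounded:
  assumes "\<And>i. i \<in> J \<Longrightarrow> legal_step G (c i) (c' i)" and "nbrs G v \<subseteq> c' ` J"
  shows "cops_force G J c v"
  using assms by (intro cops_force.move[of J G c c']) (auto simp: legal_step_def intro: cops_force.surrounded)

section \<open>Legal steps and walks of bounded length\<close>

lemma legal_step_refl [simp]: "legal_step G v v"
  by (simp add: legal_step_def)

lemma legal_step_in_pverts:
  assumes "pair_graph G" and "legal_step G u v" and "u \<in> pverts G"
  shows "v \<in> pverts G"
proof -
  interpret pair_graph G by fact
  show ?thesis using assms(2,3) by (auto simp: legal_step_def nbrs_def dest: in_arcsD2)
qed

lemma nbrs_sym: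
  assumes "pair_graph G" and "v \<in> nbrs G u"
  shows "u \<in> nbrs G v"
proof -
  interpret pair_graph G by fact
  have "sym (parcs G)" using pair_sym_arcs by (simp add: symmetric_def)
  then show ?thesis using assms(2) by (auto simp: nbrs_def sym_def)
qed

lemma connected_legal_step_rtranclp:
  assumes "pair_graph G" and "connected (with_proj G)" and "u \<in> pverts G" and "v \<in> pverts G"
  shows "(legal_step G)\<^sup>*\<^sup>* u v"
proof -
  interpret pair_graph G by fact
  have "strongly_connected (with_proj G)"
    using symmetric_connected_imp_strongly_connected assms(2) pair_sym_arcs by blast
  then have "(u, v) \<in> rtrancl_on (pverts G) (parcs G)"
    using assms(3,4) by (auto simp: strongly_connected_def reachable_def)
  then show ?thesis
    by induction (auto simp: legal_step_def nbrs_def intro: converse_rtranclp_into_rtranclp)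
qed

lemma relpowp_mono_exponent:
  assumes "reflp R" and "(R ^^ k) x y" and "k \<le> l"
  shows "(R ^^ l) x y"
  using assms(3,2)
proof (induction l rule: dec_induct)
  case (step l)
  then show ?case using assms(1) by (auto simp: reflp_def)
qed simp

text \<open>Since staying put is a legal step, short walks can be padded, and the maximum of
  finitely many lengths serves all pairs. A common length lets a whole team arrive at the same
  time.\<close>

lemma connected_diameter:
  assumes "pair_graph G" and "connected (with_proj G)"
  obtains N where "\<And>u v. u \<in> pverts G \<Longrightarrow> v \<in> pverts G \<Longrightarrow> (legal_step G ^^ N) u v"
proof -
  interpret pair_graph G by fact
  let ?V = "pverts G \<times> pverts G"
  have "\<forall>p \<in> ?V. \<exists>k. (legal_step G ^^ k) (fst p) (snd p)"
    using connected_legal_step_rtranclp[OF assms] by (auto dest: rtranclp_imp_relpowp)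
  then obtain d where d: "\<forall>p \<in> ?V. (legal_step G ^^ d p) (fst p) (snd p)"
    by (rule bchoice[THEN exE])
  have "finite (d ` ?V)" by simp
  have "(legal_step G ^^ Max (d ` ?V)) u v" if "u \<in> pverts G" "v \<in> pverts G" for u v
  proof (rule relpowp_mono_exponent)
    show "(legal_step G ^^ d (u, v)) u v" using d that by force
    show "d (u, v) \<le> Max (d ` ?V)" using that by (intro Max_ge) auto
  qed (simp add: reflp_def)
  then show thesis by (rule that)
qed

section \<open>From winning strategies to winning positions\<close>

lemma image_nth_bij_betw:
  assumes "bij_betw b J {..<length xs}"
  shows "(\<lambda>i. xs ! b i) ` J = set xs"
proof -
  have "(\<lambda>i. xs ! b i) ` J = (!) xs ` b ` J" by auto
  also have "\<dots> = (!) xs ` {..<length xs}" using assms by (simp add: bij_betw_def)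
  also have "\<dots> = set xs" by (auto simp: set_conv_nth)
  finally show ?thesis .
qed

text \<open>By contradiction: outside \<open>cops_force\<close> the robber always has a reply that
  remains outside, and a chain of such replies is an infinite play that beats \<open>S\<close>. The
  bijection \<open>b\<close> lets the cops be indexed by any set of size \<open>k\<close>.\<close>

lemma cops_force_of_winning_strategy:
  fixes b :: "'i \<Rightarrow> nat"
  assumes "winning_cop_strategy G k S" and b: "bij_betw b J {..<k}"
    and "v \<in> pverts G" and "v \<notin> set (S [])"
  shows "cops_force G J (\<lambda>i. S [] ! b i) v"
proof (rule ccontr)
  define c where "c hist = (\<lambda>i. S hist ! b i)" for hist
  assume "\<not> cops_force G J (\<lambda>i. S [] ! b i) v"
  then have nv: "\<not> cops_force G J (c []) v" by (simp add: c_def)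
  have S: "cop_strategy G k S"
    and win: "\<And>r. robber_play G S r \<Longrightarrow>
      \<exists>t. surrounded G (cops_at S r t) (r t) \<or> surrounded G (cops_at S r (Suc t)) (r t)"
    using assms(1) by (auto simp: winning_cop_strategy_def)
  have len: "length (S hist) = k" for hist
  proof (induction hist rule: rev_induct)
    case (snoc x xs)
    then show ?case using S by (metis cop_strategy_def list_all2_lengthD)
  qed (use S in \<open>simp add: cop_strategy_def\<close>)
  have im: "c hist ` J = set (S hist)" for hist
    using b image_nth_bij_betw[of b J "S hist"] by (simp add: c_def len)
  have step: "legal_step G (c hist i) (c (hist @ [x]) i)" if "i \<in> J" for hist x i
  proof -
    have "b i < k" using b that by (auto simp: bij_betw_def)
    then show ?thesis
      using S len by (auto simp: cop_strategy_def c_def list_all2_conv_all_nth)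
  qed
  \<comment> \<open>A state pairs the robber's earlier vertices with his current one;
    \<open>P\<close> says that he is safe there.\<close>
  define P where "P p \<longleftrightarrow> \<not> cops_force G J (c (fst p)) (snd p) \<and> snd p \<notin> set (S (fst p))"
    for p :: "'a list \<times> 'a"
  define Q where "Q p q \<longleftrightarrow> fst q = fst p @ [snd p] \<and> legal_step G (snd p) (snd q)"
    for p q :: "'a list \<times> 'a"
  have ex: "\<exists>q. P q \<and> Q p q" if "P p" for p
  proof -
    let ?h = "fst p @ [snd p]"
    have "\<exists>w. legal_step G (snd p) w \<and> w \<notin> c ?h ` J \<and> \<not> cops_force G J (c ?h) w"
      using that step cops_force.move[of J G "c (fst p)" "c ?h" "snd p"]
      by (auto simp: P_def)
    then show ?thesis by (force simp: P_def Q_def im)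
  qed
  have "\<exists>f. \<forall>n. (P (f n) \<and> (n = 0 \<longrightarrow> f n = ([], v))) \<and> Q (f n) (f (Suc n))"
    by (rule dependent_nat_choice) (use nv assms(4) ex in \<open>auto simp: P_def\<close>)
  then obtain f where f0: "f 0 = ([], v)" and P: "\<And>n. P (f n)" and Q: "\<And>n. Q (f n) (f (Suc n))"
    by blast
  define r where "r n = snd (f n)" for n
  have hist: "fst (f n) = map r [0..<n]" for n
  proof (induction n)
    case (Suc n)
    then show ?case using Q[of n] by (simp add: Q_def r_def)
  qed (simp add: f0)
  have at: "cops_at S r t = S (fst (f t))" for t by (simp add: cops_at_def hist)
  have "robber_play G S r"
    unfolding robber_play_def at using f0 assms(3) P Q by (auto simp: r_def P_def Q_def)
  then obtain t where "surrounded G (S (fst (f t))) (r t) \<or> surrounded G (S (fst (f (Suc t)))) (r t)"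
    using win unfolding at[symmetric] by blast
  moreover have "fst (f (Suc t)) = fst (f t) @ [snd (f t)]" using Q[of t] by (simp add: Q_def)
  ultimately have "nbrs G (r t) \<subseteq> c (fst (f t)) ` J \<or>
      nbrs G (r t) \<subseteq> c (fst (f t) @ [snd (f t)]) ` J"
    by (simp add: surrounded_def im)
  \<comment> \<open>Being surrounded before the cops' move is the constructor
    \<open>surrounded\<close>; being surrounded after it is
    \<open>cops_force_move_surrounded\<close>.\<close>
  then have "cops_force G J (c (fst (f t))) (snd (f t))"
    using step by (auto simp: r_def intro: cops_force.surrounded cops_force_move_surrounded)
  then show False using P[of t] by (simp add: P_def)
qed

text \<open>The cops walk to \<open>c\<^sub>0\<close> without regard to the robber, and where he
  stands afterwards counts as his starting vertex.\<close>

lemma cops_force_walk: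
  assumes "\<And>v. v \<in> pverts G \<Longrightarrow> v \<notin> c\<^sub>0 ` J \<Longrightarrow> cops_force G J c\<^sub>0 v" and "pair_graph G"
    and "\<And>i. i \<in> J \<Longrightarrow> (legal_step G ^^ N) (c i) (c\<^sub>0 i)" and "v \<in> pverts G"
  shows "cops_force G J c v"
  using assms(3,4)
proof (induction N arbitrary: c v)
  \<comment> \<open>The robber may stand on a cop at this point; an idle cop move forces his reply
    to be a free vertex.\<close>
  case 0
  then show ?case
    using assms(1) legal_step_in_pverts[OF assms(2)]
    by (intro cops_force.move[of J G c c\<^sub>0]) auto
next
  case (Suc N)
  have "\<forall>i\<in>J. \<exists>y. legal_step G (c i) y \<and> (legal_step G ^^ N) y (c\<^sub>0 i)"
    using Suc.prems(1) by (blast dest: relpowp_Suc_D2)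
  then obtain c' where "\<forall>i\<in>J. legal_step G (c i) (c' i) \<and> (legal_step G ^^ N) (c' i) (c\<^sub>0 i)"
    by (rule bchoice[THEN exE])
  then show ?case
    using Suc legal_step_in_pverts[OF assms(2)] by (intro cops_force.move[of J G c c']) auto
qed

text \<open>Connectedness makes the initial placement immaterial: the cops first walk to
  \<open>S []\<close>. Hence a game can be started afresh from any position by any team of the right
  size.\<close>

lemma cops_force_if_cops_win:
  assumes "pair_graph G" and "connected (with_proj G)" and "cops_win G k"
    and "finite J" and "card J = k"
    and "\<And>i. i \<in> J \<Longrightarrow> c i \<in> pverts G" and "v \<in> pverts G"
  shows "cops_force G J c v"
proof -
  obtain S where S: "winning_cop_strategy G k S" using assms(3) by (auto simp: cops_win_def)
  obtain b where b: "bij_betw b J {..<k}"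
    using assms(4,5) by (metis card_lessThan finite_lessThan finite_same_card_bij)
  let ?c = "\<lambda>i. S [] ! b i"
  have S0: "length (S []) = k" "set (S []) \<subseteq> pverts G"
    using S by (auto simp: winning_cop_strategy_def cop_strategy_def)
  have im: "?c ` J = set (S [])"
    using b S0 by (intro image_nth_bij_betw) simp
  obtain N where N: "\<And>u v. u \<in> pverts G \<Longrightarrow> v \<in> pverts G \<Longrightarrow> (legal_step G ^^ N) u v"
    using connected_diameter assms(1,2) by blast
  show ?thesis
  proof (rule cops_force_walk)
    show "cops_force G J ?c u" if "u \<in> pverts G" "u \<notin> ?c ` J" for u
      using cops_force_of_winning_strategy[OF S b] that im by simp
    show "(legal_step G ^^ N) (c i) (?c i)" if "i \<in> J" for i
      using that im S0 assms(6) by (intro N) auto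
  qed (use assms in auto)
qed

section \<open>From winning positions back to strategies\<close>

definition moves_legally :: "'a pair_pre_digraph \<Rightarrow> ('a list \<Rightarrow> 'a list) \<Rightarrow> bool" where
  "moves_legally G S \<longleftrightarrow> (\<forall>hist x. list_all2 (legal_step G) (S hist) (S (hist @ [x])))"

definition wins_against :: "'a pair_pre_digraph \<Rightarrow> ('a list \<Rightarrow> 'a list) \<Rightarrow> 'a \<Rightarrow> bool" where
  "wins_against G S v \<longleftrightarrow> (\<forall>r. robber_play G S r \<longrightarrow> r 0 = v \<longrightarrow>
    (\<exists>t. surrounded G (cops_at S r t) (r t) \<or> surrounded G (cops_at S r (Suc t)) (r t)))"

lemma moves_legally_const: "moves_legally G (\<lambda>_. C)"
  by (simp add: moves_legally_def list.rel_refl)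

text \<open>A winning move is followed by the strategy that the induction hypothesis gives for the
  robber's actual reply, run on the history without its first entry.\<close>

lemma strategy_of_cops_force:
  assumes "pair_graph G" and "cops_force G {..<k} c v"
  shows "\<exists>S. S [] = map c [0..<k] \<and> moves_legally G S \<and> wins_against G S v"
  using assms(2)
proof induction
  case (surrounded v c)
  have "wins_against G (\<lambda>_. map c [0..<k]) v"
    using surrounded by (auto simp: wins_against_def surrounded_def cops_at_def atLeast0LessThan)
  then show ?case
    by (intro exI[of _ "\<lambda>_. map c [0..<k]"]) (simp add: moves_legally_const)
next
  case (move c c' v)
  define good where "good w \<longleftrightarrow> legal_step G v w \<and> w \<notin> c' ` {..<k}" for w
  \<comment> \<open>A strategy is chosen for every \<open>w\<close>; where nothing has to be won,
    standing still is legal.\<close>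
  have "\<exists>S. S [] = map c' [0..<k] \<and> moves_legally G S \<and> (good w \<longrightarrow> wins_against G S w)" for w
  proof (cases "good w")
    case True
    then show ?thesis using move.IH[of w] unfolding good_def by blast
  next
    case False
    then show ?thesis
      by (intro exI[of _ "\<lambda>_. map c' [0..<k]"]) (simp add: moves_legally_const)
  qed
  then obtain T where T: "\<And>w. T w [] = map c' [0..<k]" "\<And>w. moves_legally G (T w)"
    "\<And>w. good w \<Longrightarrow> wins_against G (T w) w"
    by metis
  \<comment> \<open>If \<open>ys\<close> is empty, \<open>hd ys\<close> is arbitrary, but all
    \<open>T w\<close> agree on the empty history.\<close>
  define S where "S hist = (case hist of [] \<Rightarrow> map c [0..<k] | x # ys \<Rightarrow> T (hd ys) ys)" for hist
  have S_tail: "S (x # ys) = T w ys" if "ys \<noteq> [] \<Longrightarrow> hd ys = w" for x ys w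
    using that T(1) by (cases ys) (auto simp: S_def)
  have "list_all2 (legal_step G) (S hist) (S (hist @ [x]))" for hist x
  proof (cases hist)
    case Nil
    then show ?thesis using move.hyps(1) T(1)
      by (auto simp: S_def list_all2_conv_all_nth)
  next
    case (Cons y ys)
    let ?w = "hd (ys @ [x])"
    have "S hist = T ?w ys" unfolding Cons by (rule S_tail) simp
    moreover have "S (hist @ [x]) = T ?w (ys @ [x])" unfolding Cons append_Cons by (rule S_tail) simp
    ultimately show ?thesis using T(2) by (simp add: moves_legally_def)
  qed
  then have "moves_legally G S" by (simp add: moves_legally_def)
  moreover have "wins_against G S v"
    unfolding wins_against_def
  proof (intro allI impI)
    fix r assume r: "robber_play G S r" and r0: "r 0 = v"
    define r' where "r' t = r (Suc t)" for t
    have at: "cops_at S r (Suc t) = cops_at (T (r' 0)) r' t" for t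
    proof -
      have "map r [0..<Suc t] = r 0 # map r' [0..<t]"
        by (simp add: upt_conv_Cons r'_def map_Suc_upt[symmetric] del: upt_Suc)
      moreover have "map r' [0..<t] \<noteq> [] \<Longrightarrow> hd (map r' [0..<t]) = r' 0"
        by (simp add: hd_map)
      ultimately show ?thesis by (metis S_tail cops_at_def)
    qed
    have notin: "r' t \<notin> set (cops_at (T (r' 0)) r' t)" for t
      using r at[of t] by (metis r'_def robber_play_def)
    have "good (r' 0)"
      using r r0 notin[of 0] T(1) by (auto simp: good_def r'_def robber_play_def cops_at_def)
    then have "wins_against G (T (r' 0)) (r' 0)" by (rule T(3))
    moreover have "robber_play G (T (r' 0)) r'"
    proof -
      have "r' 0 \<in> pverts G"
        using r legal_step_in_pverts[OF assms(1)] unfolding robber_play_def r'_def by blast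
      then show ?thesis using r notin by (simp add: robber_play_def r'_def)
    qed
    ultimately obtain t where "surrounded G (cops_at S r (Suc t)) (r (Suc t)) \<or>
        surrounded G (cops_at S r (Suc (Suc t))) (r (Suc t))"
      unfolding wins_against_def at r'_def by blast
    then show "\<exists>t. surrounded G (cops_at S r t) (r t) \<or> surrounded G (cops_at S r (Suc t)) (r t)"
      by blast
  qed
  moreover have "S [] = map c [0..<k]" by (simp add: S_def)
  ultimately show ?case by blast
qed

text \<open>The strategies for the single starting vertices share their initial placement, so they
  can be glued by the first entry of the history.\<close>

lemma cops_win_if_cops_force:
  assumes "pair_graph G" and "set (map c [0..<k]) \<subseteq> pverts G"
    and "\<And>v. v \<in> pverts G \<Longrightarrow> cops_force G {..<k} c v"
  shows "cops_win G k"
proof -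
  have "\<exists>S. S [] = map c [0..<k] \<and> moves_legally G S \<and> (v \<in> pverts G \<longrightarrow> wins_against G S v)" for v
  proof (cases "v \<in> pverts G")
    case True
    then show ?thesis using strategy_of_cops_force[OF assms(1) assms(3)[OF True]] by simp
  next
    case False
    then show ?thesis
      by (intro exI[of _ "\<lambda>_. map c [0..<k]"]) (simp add: moves_legally_const)
  qed
  then obtain T where T: "\<And>v. T v [] = map c [0..<k]" "\<And>v. moves_legally G (T v)"
    "\<And>v. v \<in> pverts G \<Longrightarrow> wins_against G (T v) v"
    by metis
  define S where "S hist = T (hd hist) hist" for hist
  have S_hd: "S hist = T w hist" if "hist \<noteq> [] \<Longrightarrow> hd hist = w" for hist w
    using that T(1) by (cases hist) (auto simp: S_def)
  have "list_all2 (legal_step G) (S hist) (S (hist @ [x]))" for hist x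
  proof -
    have "S hist = T (hd (hist @ [x])) hist" by (rule S_hd) simp
    then show ?thesis using T(2) by (simp add: S_def moves_legally_def)
  qed
  then have "cop_strategy G k S" using T(1) assms(2) by (simp add: cop_strategy_def S_def)
  moreover have "\<exists>t. surrounded G (cops_at S r t) (r t) \<or> surrounded G (cops_at S r (Suc t)) (r t)"
    if r: "robber_play G S r" for r
  proof -
    have at: "cops_at S r t = cops_at (T (r 0)) r t" for t
      unfolding cops_at_def by (rule S_hd) (simp add: hd_map)
    then have "robber_play G (T (r 0)) r" using r by (simp add: robber_play_def)
    moreover have "wins_against G (T (r 0)) (r 0)" using r by (intro T(3)) (simp add: robber_play_def)
    ultimately show ?thesis unfolding wins_against_def at by blast
  qed
  ultimately show ?thesis unfolding cops_win_def winning_cop_strategy_def by blast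
qed

section \<open>Rounds of play on the Cartesian product\<close>

lemma legal_step_cartesian_product:
  assumes "g \<in> pverts G" and "h \<in> pverts H"
  shows "legal_step (G \<box> H) (g, h) p \<longleftrightarrow>
    (\<exists>g'. p = (g', h) \<and> legal_step G g g') \<or> (\<exists>h'. p = (g, h') \<and> legal_step H h h')"
  using assms by (auto simp: legal_step_def nbrs_def cartesian_product_def)

lemma nbrs_cartesian_product:
  "nbrs (G \<box> H) (g, h) \<subseteq> (\<lambda>g'. (g', h)) ` nbrs G g \<union> Pair g ` nbrs H h"
  by (auto simp: nbrs_def cartesian_product_def)

text \<open>The index set is left abstract so that teams are simply subsets of it.\<close>

locale cop_teams =
  fixes G :: "'a pair_pre_digraph" and H :: "'b pair_pre_digraph"
    and m n :: nat and I :: "'i set"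
  assumes G: "pair_graph G" "connected (with_proj G)" "cops_win G m"
    and H: "pair_graph H" "connected (with_proj H)" "cops_win H n"
    and n_pos: "n \<ge> 1"
    and I: "finite I" "card I = m + n"
begin

definition on_board :: "('i \<Rightarrow> 'a \<times> 'b) \<Rightarrow> bool" where
  "on_board C \<longleftrightarrow> (\<forall>i\<in>I. fst (C i) \<in> pverts G \<and> snd (C i) \<in> pverts H)"

text \<open>One round of play with the robber's replies sorted by the coordinate that changes. A
  pass is counted as an \<open>H\<close>-move.\<close>

lemma cops_force_product_move:
  assumes "on_board C" and "g \<in> pverts G" and "h \<in> pverts H"
    and step: "\<And>i. i \<in> I \<Longrightarrow> legal_step G (fst (C i)) (fst (C' i)) \<and> snd (C' i) = snd (C i) \<or>
      legal_step H (snd (C i)) (snd (C' i)) \<and> fst (C' i) = fst (C i)"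
    and G_move: "\<And>g'. on_board C' \<Longrightarrow> g' \<in> nbrs G g \<Longrightarrow> g' \<in> pverts G \<Longrightarrow> (g', h) \<notin> C' ` I \<Longrightarrow>
      cops_force (G \<box> H) I C' (g', h)"
    and H_move: "\<And>h'. on_board C' \<Longrightarrow> legal_step H h h' \<Longrightarrow> h' \<in> pverts H \<Longrightarrow> (g, h') \<notin> C' ` I \<Longrightarrow>
      cops_force (G \<box> H) I C' (g, h')"
  shows "cops_force (G \<box> H) I C (g, h)"
proof -
  have C': "legal_step (G \<box> H) (C i) (C' i) \<and> fst (C' i) \<in> pverts G \<and> snd (C' i) \<in> pverts H"
    if "i \<in> I" for i
  proof -
    obtain x y x' y' where eq: "C i = (x, y)" "C' i = (x', y')" by fastforce
    have xy: "x \<in> pverts G" "y \<in> pverts H"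
      using assms(1) that eq unfolding on_board_def by force+
    show ?thesis
      using step[OF that] xy legal_step_in_pverts[OF G(1)] legal_step_in_pverts[OF H(1)]
      by (auto simp: eq legal_step_cartesian_product)
  qed
  then have ob: "on_board C'" by (simp add: on_board_def)
  show ?thesis
  proof (rule cops_force.move[of I "G \<box> H" C C'])
    fix p assume p: "legal_step (G \<box> H) (g, h) p" "p \<notin> C' ` I"
    then consider g' where "p = (g', h)" "g' \<in> nbrs G g" | h' where "p = (g, h')" "legal_step H h h'"
      using legal_step_cartesian_product[OF assms(2,3), of p] by (auto simp: legal_step_def[of G])
    then show "cops_force (G \<box> H) I C' p"
    proof cases
      case 1
      then have "g' \<in> pverts G"
        using assms(2) legal_step_in_pverts[OF G(1)] by (auto simp: legal_step_def)
      then show ?thesis using 1 p ob G_move by simp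
    next
      case 2
      then have "h' \<in> pverts H" using assms(3) legal_step_in_pverts[OF H(1)] by blast
      then show ?thesis using 2 p ob H_move by simp
    qed
  qed (use C' in blast)
qed

end

section \<open>Team \<open>A\<close> plays on \<open>G\<close> while team \<open>B\<close> plays on
  \<open>H\<close>\<close>

locale split_teams = cop_teams G H m n I
  for G :: "'a pair_pre_digraph" and H :: "'b pair_pre_digraph"
    and m n :: nat and I :: "'i set" +
  fixes A B :: "'i set"
  assumes AB: "A \<union> B = I" "A \<inter> B = {}" "card A = m"
begin

lemma finite_teams: "finite A" "finite B" and card_B: "card B = n"
proof -
  show fin: "finite A" "finite B" using I(1) AB(1) by (metis finite_Un)+
  show "card B = n" using I(2) AB card_Un_disjoint[OF fin AB(2)] by simp
qed

text \<open>
  The assumptions \<open>G_move\<close> and \<open>G_stay\<close> say that the cops win once the robber advances the game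
  on \<open>G\<close> from the position in which team \<open>A\<close> is at \<open>c\<close>. Only when team \<open>B\<close> surrounds the robber in the
  \<open>H\<close>-direction is his passing counted as advancing that game; before, it is a pass in the game
  on \<open>H\<close>.
\<close>

lemma cops_force_following_H:
  assumes g: "g \<in> pverts G"
    and G_move: "\<And>C g' h. on_board C \<Longrightarrow> g' \<in> nbrs G g \<Longrightarrow> g' \<in> pverts G \<Longrightarrow> h \<in> pverts H \<Longrightarrow>
      g' \<notin> c ` A \<Longrightarrow> (\<And>i. i \<in> A \<Longrightarrow> C i = (c i, h)) \<Longrightarrow> cops_force (G \<box> H) I C (g', h)"
    and G_stay: "nbrs G g \<subseteq> c ` A \<or> (\<forall>C h. on_board C \<longrightarrow> h \<in> pverts H \<longrightarrow> g \<notin> c ` A \<longrightarrow>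
      (\<forall>i\<in>A. C i = (c i, h)) \<longrightarrow> cops_force (G \<box> H) I C (g, h))"
    and C: "on_board C" "\<And>i. i \<in> A \<Longrightarrow> C i = (c i, h\<^sub>0)" "legal_step H h\<^sub>0 h" "h \<in> pverts H"
  shows "cops_force (G \<box> H) I C (g, h)"
proof -
  have notin: "g' \<notin> c ` A" if "(g', h) \<notin> C ` I" "\<And>i. i \<in> A \<Longrightarrow> C i = (c i, h)"
    for C :: "'i \<Rightarrow> 'a \<times> 'b" and g' h
    using that AB(1) by force
  have B_surrounds: "cops_force (G \<box> H) I C (g, h)"
    \<comment> \<open>Team \<open>A\<close> is one \<open>H\<close>-step behind and catches up while
      \<open>B\<close> closes in. Either both teams together now cover all neighbours in the
      product, or the robber is left with a \<open>G\<close>-move or a pass.\<close>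
    if C: "on_board C" "\<And>i. i \<in> A \<Longrightarrow> C i = (c i, h\<^sub>0)" "legal_step H h\<^sub>0 h" "h \<in> pverts H"
      and d: "\<And>i. i \<in> B \<Longrightarrow> C i = (g, d i)" "\<And>i. i \<in> B \<Longrightarrow> legal_step H (d i) (d' i)"
        "nbrs H h \<subseteq> d' ` B"
    for C h\<^sub>0 h d d'
  proof (cases "nbrs G g \<subseteq> c ` A")
    case True
    let ?C = "\<lambda>i. if i \<in> A then (c i, h) else (g, d' i)"
    have "nbrs (G \<box> H) (g, h) \<subseteq> ?C ` I"
    proof -
      have A: "(\<lambda>g'. (g', h)) ` nbrs G g \<subseteq> ?C ` A" using True by auto
      have B: "Pair g ` nbrs H h \<subseteq> ?C ` B" using d(3) AB(2) by force
      have I: "?C ` I = ?C ` A \<union> ?C ` B" unfolding AB(1)[symmetric] by (rule image_Un)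
      show ?thesis unfolding I using nbrs_cartesian_product Un_mono[OF A B] by (rule subset_trans)
    qed
    moreover have "legal_step (G \<box> H) (C i) (?C i)" if "i \<in> I" for i
    proof -
      have v: "fst (C i) \<in> pverts G" "snd (C i) \<in> pverts H"
        using C(1) that unfolding on_board_def by blast+
      show ?thesis
      proof (cases "i \<in> A")
        case True
        then show ?thesis using C(2)[OF True] C(3) v by (simp add: legal_step_cartesian_product)
      next
        case False
        then have "i \<in> B" using that AB(1) by blast
        then show ?thesis
          using False d(1,2)[of i] v by (simp add: legal_step_cartesian_product)
      qed
    qed
    ultimately show ?thesis by (intro cops_force_move_surrounded)
  next
    case False
    let ?C = "\<lambda>i. if i \<in> A then (c i, h) else (g, d' i)"
    show ?thesis
    proof (rule cops_force_product_move[OF C(1) g C(4), of ?C])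
      show "cops_force (G \<box> H) I ?C (g', h)"
        if "on_board ?C" "g' \<in> nbrs G g" "g' \<in> pverts G" "(g', h) \<notin> ?C ` I" for g'
        using that C(4) notin[of g' h ?C] by (intro G_move) auto
      show "cops_force (G \<box> H) I ?C (g, h')"
        if that: "on_board ?C" "legal_step H h h'" "h' \<in> pverts H" "(g, h') \<notin> ?C ` I" for h'
      proof -
        have "h' \<notin> d' ` B"
        proof
          assume "h' \<in> d' ` B"
          then obtain i where "i \<in> B" "h' = d' i" by blast
          then have "(g, h') = ?C i" "i \<in> I" using AB by auto
          then show False using that(4) by blast
        qed
        then have "h' = h" using that(2) d(3) by (auto simp: legal_step_def)
        then show ?thesis using G_stay False that notin[of g h ?C] by auto
      qed
    qed (use C(2,3) d(1,2) AB(1) in auto)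
  qed
  have B_aligned: "cops_force (G \<box> H) I C (g, h)"
    if "cops_force H B d h" "on_board C" "\<And>i. i \<in> A \<Longrightarrow> C i = (c i, h\<^sub>0)" "legal_step H h\<^sub>0 h"
      "h \<in> pverts H" and "\<And>i. i \<in> B \<Longrightarrow> C i = (g, d i)"
    for d C h\<^sub>0 h
    using that
  proof (induction arbitrary: C h\<^sub>0)
    case (surrounded h d)
    then show ?case by (intro B_surrounds[of C h\<^sub>0 h d d]) auto
  next
    case (move d d' h)
    let ?C = "\<lambda>i. if i \<in> A then (c i, h) else (g, d' i)"
    show ?case
    proof (rule cops_force_product_move[OF move.prems(1) g move.prems(4), of ?C])
      show "cops_force (G \<box> H) I ?C (g', h)"
        if "on_board ?C" "g' \<in> nbrs G g" "g' \<in> pverts G" "(g', h) \<notin> ?C ` I" for g'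
        using that move.prems(4) notin[of g' h ?C] by (intro G_move) auto
      show "cops_force (G \<box> H) I ?C (g, h')"
        if that: "on_board ?C" "legal_step H h h'" "h' \<in> pverts H" "(g, h') \<notin> ?C ` I" for h'
      proof -
        have "h' \<notin> d' ` B"
        proof
          assume "h' \<in> d' ` B"
          then obtain i where "i \<in> B" "h' = d' i" by blast
          then have "(g, h') = ?C i" "i \<in> I" using AB by auto
          then show False using that(4) by blast
        qed
        then show ?thesis using that AB(2) by (intro move.IH[of h' ?C h]) auto
      qed
    qed (use move.prems move.hyps(1) AB(1) in auto)
  qed
  \<comment> \<open>While the robber makes no \<open>G\<close>-move, \<open>B\<close> walks to the
    coordinate \<open>g\<close>; the game on \<open>H\<close> then starts from wherever its second
    coordinates are.\<close>
  have B_walk: "cops_force (G \<box> H) I C (g, h)"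
    if "on_board C" "\<And>i. i \<in> A \<Longrightarrow> C i = (c i, h\<^sub>0)" "legal_step H h\<^sub>0 h" "h \<in> pverts H"
      and "\<And>i. i \<in> B \<Longrightarrow> (legal_step G ^^ N) (fst (C i)) g"
    for N C h\<^sub>0 h
    using that
  proof (induction N arbitrary: C h\<^sub>0 h)
    case 0
    have "cops_force H B (snd \<circ> C) h"
      using 0(1,4) AB(1) finite_teams card_B by (intro cops_force_if_cops_win[OF H]) (auto simp: on_board_def)
    then show ?case
    proof (rule B_aligned[OF _ 0(1-4)])
      show "C i = (g, (snd \<circ> C) i)" if "i \<in> B" for i
        using 0(5)[OF that] by (auto simp: prod_eq_iff)
    qed
  next
    case (Suc N)
    have "\<forall>i\<in>B. \<exists>y. legal_step G (fst (C i)) y \<and> (legal_step G ^^ N) y g"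
      using Suc.prems(5) by (blast dest: relpowp_Suc_D2)
    then obtain e where e: "\<forall>i\<in>B. legal_step G (fst (C i)) (e i) \<and> (legal_step G ^^ N) (e i) g"
      by (rule bchoice[THEN exE])
    let ?C = "\<lambda>i. if i \<in> A then (c i, h) else (e i, snd (C i))"
    show ?case
    proof (rule cops_force_product_move[OF Suc.prems(1) g Suc.prems(4), of ?C])
      show "cops_force (G \<box> H) I ?C (g', h)"
        if "on_board ?C" "g' \<in> nbrs G g" "g' \<in> pverts G" "(g', h) \<notin> ?C ` I" for g'
        using that Suc.prems(4) notin[of g' h ?C] by (intro G_move) auto
      show "cops_force (G \<box> H) I ?C (g, h')"
        if that: "on_board ?C" "legal_step H h h'" "h' \<in> pverts H" for h'
        using that e AB(2) by (intro Suc.IH[of ?C h h']) auto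
    qed (use Suc.prems e AB(1) in auto)
  qed
  obtain N where N: "\<And>u v. u \<in> pverts G \<Longrightarrow> v \<in> pverts G \<Longrightarrow> (legal_step G ^^ N) u v"
    using connected_diameter G(1,2) by blast
  show ?thesis
  proof (rule B_walk[OF C])
    show "(legal_step G ^^ N) (fst (C i)) g" if "i \<in> B" for i
      using C(1) that AB(1) g by (intro N) (auto simp: on_board_def)
  qed
qed

text \<open>Induction on the game on \<open>G\<close>: each \<open>G\<close>-move of the robber
  advances it, and a phase of \<open>H\<close>-moves is handled by
  \<open>cops_force_following_H\<close>.\<close>

lemma cops_force_aligned:
  assumes "cops_force G A c g" and "on_board C" and "g \<in> pverts G" and "h \<in> pverts H"
    and "\<And>i. i \<in> A \<Longrightarrow> C i = (c i, h)"
  shows "cops_force (G \<box> H) I C (g, h)"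
  using assms
proof (induction arbitrary: C h)
  case (surrounded g c)
  then show ?case by (intro cops_force_following_H[of g c C h h]) auto
next
  case (move c c' g)
  let ?C = "\<lambda>i. if i \<in> A then (c' i, h) else C i"
  show ?case
  proof (rule cops_force_product_move[OF move.prems(1-3), of ?C])
    show "cops_force (G \<box> H) I ?C (g', h)"
      if "on_board ?C" "g' \<in> nbrs G g" "g' \<in> pverts G" "(g', h) \<notin> ?C ` I" for g'
    proof -
      have "g' \<notin> c' ` A" using that(4) AB(1) by force
      then show ?thesis using that move.prems(3) by (intro move.IH) (auto simp: legal_step_def)
    qed
    show "cops_force (G \<box> H) I ?C (g, h')"
      if "on_board ?C" "legal_step H h h'" "h' \<in> pverts H" for h'
    \<comment> \<open>The induction hypothesis yields both \<open>G_move\<close> and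
      \<open>G_stay\<close>, the latter as a pass at \<open>g\<close> in the game on
      \<open>G\<close>.\<close>
    proof (rule cops_force_following_H[of g c' ?C h h'])
      show "cops_force (G \<box> H) I D (g', y)"
        if "on_board D" "g' \<in> nbrs G g" "g' \<in> pverts G" "y \<in> pverts H" "g' \<notin> c' ` A"
          "\<And>i. i \<in> A \<Longrightarrow> D i = (c' i, y)" for D g' y
        using that by (intro move.IH) (auto simp: legal_step_def)
    qed (use that move.prems(2) move.IH[of g] in auto)
  qed (use move.prems(4) move.hyps(1) in auto)
qed

text \<open>Team \<open>A\<close> steps onto level \<open>h\<close> and starts the game on
  \<open>G\<close> from its current first coordinates. If the robber meanwhile makes an
  \<open>H\<close>-move, the team is one step behind, as \<open>cops_force_following_H\<close>
  allows.\<close>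

lemma cops_force_near_level:
  assumes "on_board C" and "g \<in> pverts G" and "h \<in> pverts H"
    and "\<And>i. i \<in> A \<Longrightarrow> legal_step H (snd (C i)) h"
  shows "cops_force (G \<box> H) I C (g, h)"
proof -
  let ?C = "\<lambda>i. if i \<in> A then (fst (C i), h) else C i"
  have G_force: "cops_force G A (fst \<circ> C) g'" if "g' \<in> pverts G" for g'
    using that assms(1) AB(1,3) finite_teams by (intro cops_force_if_cops_win[OF G]) (auto simp: on_board_def)
  have aligned: "cops_force (G \<box> H) I D (g', y)"
    if "on_board D" "g' \<in> pverts G" "y \<in> pverts H" "\<And>i. i \<in> A \<Longrightarrow> D i = (fst (C i), y)" for D g' y
    using that by (intro cops_force_aligned[OF G_force]) auto
  show ?thesis
  proof (rule cops_force_product_move[OF assms(1-3), of ?C])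
    show "cops_force (G \<box> H) I ?C (g', h)" if "on_board ?C" "g' \<in> pverts G" for g'
      using that assms(3) by (intro aligned) auto
    show "cops_force (G \<box> H) I ?C (g, h')"
      if "on_board ?C" "legal_step H h h'" "h' \<in> pverts H" for h'
      using that assms(2) aligned by (intro cops_force_following_H[of g "fst \<circ> C" ?C h h']) auto
  qed (use assms(4) in auto)
qed

end

section \<open>Bringing a team onto the robber's level\<close>

context cop_teams
begin

text \<open>A surrounding cop stands on a neighbour of \<open>h\<close>, hence one step away; this
  is how winning on \<open>H\<close> recruits a cop for team \<open>A\<close>.\<close>

lemma surrounded_H_legal_step:
  assumes "nbrs H h \<subseteq> d ` J" and "h \<in> pverts H" and "J \<noteq> {}" and "d ` J \<subseteq> pverts H"
  obtains j where "j \<in> J" and "legal_step H (d j) h"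
proof (cases "nbrs H h = {}")
  case True
  obtain j where j: "j \<in> J" using assms(3) by blast
  \<comment> \<open>If \<open>h\<close> has no neighbours, connectedness puts every cop on
    \<open>h\<close> itself.\<close>
  then have "(legal_step H)\<^sup>*\<^sup>* h (d j)"
    using assms(2,4) by (intro connected_legal_step_rtranclp[OF H(1,2)]) auto
  then have "d j = h" by induction (use True in \<open>auto simp: legal_step_def\<close>)
  then show ?thesis using j that by auto
next
  case False
  then obtain j where "j \<in> J" "d j \<in> nbrs H h" using assms(1) by blast
  then show ?thesis using that nbrs_sym[OF H(1)] by (auto simp: legal_step_def)
qed

text \<open>Team \<open>A\<close> is within one step of the robber's \<open>H\<close>-coordinate and is enlarged up to size \<open>m\<close>.\<close>

lemma cops_force_product:
  assumes "A \<subseteq> I" and "card A \<le> m"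
    and "on_board C" and "g \<in> pverts G" and "h \<in> pverts H"
    and "\<And>i. i \<in> A \<Longrightarrow> legal_step H (snd (C i)) h"
  shows "cops_force (G \<box> H) I C (g, h)"
  using assms
proof (induction "m - card A" arbitrary: A C g h)
  case 0
  interpret split_teams G H m n I A "I - A"
    by unfold_locales (use 0 in auto)
  show ?case using 0 by (intro cops_force_near_level) auto
next
  case (Suc l)
  have finA: "finite A" using Suc.prems(1) I(1) finite_subset by blast
  \<comment> \<open>Fewer than \<open>m\<close> of the \<open>m + n\<close> cops are in
    \<open>A\<close>, so \<open>n\<close> others can play on \<open>H\<close>.\<close>
  have "card (I - A) \<ge> n"
    using card_Diff_subset[OF finA Suc.prems(1)] Suc.prems(2) I(2) by simp
  then obtain J where J: "J \<subseteq> I - A" "card J = n" "finite J"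
    using obtain_subset_with_card_n by metis
  then have "J \<noteq> {}" using n_pos by auto
  \<comment> \<open>A cop of \<open>J\<close> within one step of the robber's level joins
    \<open>A\<close>, and the outer induction applies.\<close>
  have capture: "cops_force (G \<box> H) I C (g, h)"
    if "on_board C" "g \<in> pverts G" "h \<in> pverts H" "\<And>i. i \<in> A \<Longrightarrow> legal_step H (snd (C i)) h"
      and j: "j \<in> J" "legal_step H (snd (C j)) h" for C g h j
  proof -
    have "j \<notin> A" "j \<in> I" using j(1) J(1) by auto
    then show ?thesis using that Suc.hyps(2) Suc.prems(1) finA
      by (intro Suc.hyps(1)[of "insert j A"]) auto
  qed
  \<comment> \<open>Inner induction on the game on \<open>H\<close> played by the second coordinates
    of \<open>J\<close>; the robber's \<open>G\<close>-moves are passes in it.\<close>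
  have "cops_force (G \<box> H) I C (g, h)"
    if "cops_force H J d h" "on_board C" "g \<in> pverts G" "h \<in> pverts H"
      "\<And>i. i \<in> A \<Longrightarrow> legal_step H (snd (C i)) h" "\<And>j. j \<in> J \<Longrightarrow> snd (C j) = d j"
    for d C g h
    using that
  proof (induction arbitrary: C g)
    case (surrounded h d)
    have "d ` J \<subseteq> pverts H"
      using surrounded.prems(1,5) J(1) unfolding on_board_def by (metis Diff_iff image_subsetI subsetD)
    then obtain j where "j \<in> J" "legal_step H (d j) h"
      using surrounded_H_legal_step surrounded \<open>J \<noteq> {}\<close> by blast
    then show ?case using surrounded.prems by (intro capture[of C g h j]) auto
  next
    case (move d d' h)
    let ?C = "\<lambda>i. if i \<in> A then (fst (C i), h) else if i \<in> J then (fst (C i), d' i) else C i"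
    have JA: "i \<notin> A" if "i \<in> J" for i using that J(1) by auto
    show ?case
    proof (rule cops_force_product_move[OF move.prems(1-3), of ?C])
      have reply: "cops_force (G \<box> H) I ?C (g', h')"
        if "on_board ?C" "g' \<in> pverts G" "legal_step H h h'" "h' \<in> pverts H" for g' h'
      proof (cases "h' \<in> d' ` J")
        case True
        then show ?thesis using that JA by (auto intro!: capture)
      next
        case False
        then show ?thesis using that JA by (intro move.IH) auto
      qed
      show "cops_force (G \<box> H) I ?C (g', h)" if "on_board ?C" "g' \<in> pverts G" for g'
        using that move.prems(3) by (intro reply) auto
      show "cops_force (G \<box> H) I ?C (g, h')"
        if "on_board ?C" "legal_step H h h'" "h' \<in> pverts H" for h'
        using that move.prems(2) by (intro reply) auto
    qed (use move.prems move.hyps(1) JA in auto)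
  qed
  moreover have "cops_force H J (snd \<circ> C) h"
    using Suc.prems J by (intro cops_force_if_cops_win[OF H]) (auto simp: on_board_def)
  ultimately show ?case using Suc.prems by simp
qed

end

section \<open>The bound for the product\<close>

lemma cops_win_cartesian_product:
  assumes "pair_graph G" and "connected (with_proj G)" and "cops_win G m"
    and "pair_graph H" and "connected (with_proj H)" and "cops_win H n" and "n \<ge> 1"
  shows "cops_win (G \<box> H) (m + n)"
proof -
  interpret cop_teams G H m n "{..<m + n}"
    by (rule cop_teams.intro) (use assms in auto)
  obtain g\<^sub>0 h\<^sub>0 where v\<^sub>0: "g\<^sub>0 \<in> pverts G" "h\<^sub>0 \<in> pverts H"
    using assms(2,5) by (auto simp: connected_def strongly_connected_def)
  show ?thesis
  proof (rule cops_win_if_cops_force)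
    show "pair_graph (G \<box> H)" using assms by (intro pair_graph_cartesian_product)
    show "set (map (\<lambda>_. (g\<^sub>0, h\<^sub>0)) [0..<m + n]) \<subseteq> pverts (G \<box> H)"
      using v\<^sub>0 by (auto simp: cartesian_product_def)
    show "cops_force (G \<box> H) {..<m + n} (\<lambda>_. (g\<^sub>0, h\<^sub>0)) p" if "p \<in> pverts (G \<box> H)" for p
      \<comment> \<open>Recruitment starts from the empty team, so all cops may begin on one
        vertex.\<close>
      using that v\<^sub>0 cops_force_product[of "{}" "\<lambda>_. (g\<^sub>0, h\<^sub>0)" "fst p" "snd p"]
      by (auto simp: cartesian_product_def on_board_def)
  qed
qed

lemma surrounding_cop_number_connected:
  assumes "pair_graph G" and "connected (with_proj G)"
  shows "\<sigma> G \<ge> 1 \<and> cops_win G (\<sigma> G)"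
proof -
  interpret pair_graph G by fact
  show ?thesis using assms(2)
    by (intro surrounding_cop_number_wellposed) (auto simp: connected_def strongly_connected_def)
qed

theorem theorem16:
  fixes G :: "'a pair_pre_digraph" and H :: "'b pair_pre_digraph"
  assumes "pair_graph G" and "connected (with_proj G)"
    and "pair_graph H" and "connected (with_proj H)"
  shows "\<sigma> (G \<box> H) \<le> \<sigma> G + \<sigma> H"
proof -
  note \<sigma>_G = surrounding_cop_number_connected[OF assms(1,2)]
    and \<sigma>_H = surrounding_cop_number_connected[OF assms(3,4)]
  have "cops_win (G \<box> H) (\<sigma> G + \<sigma> H)"
    using assms \<sigma>_G \<sigma>_H by (intro cops_win_cartesian_product) auto
  then show ?thesis
    unfolding surrounding_cop_number_def[of "G \<box> H"] using \<sigma>_H by (intro Least_le) simp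
qed

end
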